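(* Let $T>0$, let $\Psi_1,\Psi_2:[\mathbb{R}]_T\to\mathbb{R}$ be smooth, and consider the system $$\ddot s=\Psi_1(s)+\Psi_2(s)\dot s^2$$ with state space $T[\mathbb{R}]_T=[\mathbb{R}]_T\times\mathbb{R}$. The following statements are equivalent: (i) The system is Euler-Lagrange (EL). (ii) The system is mechanical. (iii) The virtual mass $\tilde M$ and the virtual potential $\tilde V$ are $T$-periodic. Moreover, if the system is EL, then a Lagrangian function $L:T[\mathbb{R}]_T\to\mathbb{R}$ for it is given by $L(s,\dot s)=\frac12M(s)\dot s^2-V(s)$, where $M:[\mathbb{R}]_T\to(0,\infty)$ and $V:[\mathbb{R}]_T\to\mathbb{R}$ are the unique smooth functions such that $\tilde M=M\circ\pi$ and $\tilde V=V\circ\pi$.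
   Context: $[\mathbb{R}]_T$ denotes the real numbers modulo $T$, a smooth manifold diffeomorphic to the circle; $\pi:\mathbb{R}\to[\mathbb{R}]_T$, $\pi(x)=[x]_T=x$ modulo $T$. Put $\tilde\Psi_i=\Psi_i\circ\pi:\mathbb{R}\to\mathbb{R}$, $i=1,2$. The virtual mass $\tilde M:\mathbb{R}\to(0,\infty)$ and virtual potential $\tilde V:\mathbb{R}\to\mathbb{R}$ are $$\tilde M(x)=\exp\Big(-2\int_0^x\tilde\Psi_2(\tau)\,d\tau\Big),\qquad\tilde V(x)=-\int_0^x\tilde\Psi_1(\tau)\tilde M(\tau)\,d\tau.$$ With $\mathcal X=T[\mathbb{R}]_T$, the system is Euler-Lagrange (EL) with Lagrangian $L$ if $L:\mathcal X\to\mathbb{R}$ is smooth and: (i) $L$ is nondegenerate, i.e. $\partial^2L/\partial\dot s^2>0$ on $\mathcal X$; (ii) all solutions $(s(t),\dot s(t))$ of the system satisfy $\frac{d}{dt}\frac{\partial L}{\partial\dot s}(s(t),\dot s(t))-\frac{\partial L}{\partial s}(s(t),\dot s(t))=0$ for all $t$ in their maximal interval of definition. The system is EL if it is EL with some such $L$. It is mechanical if it is EL with Lagrangian $L(s,\dot s)=\frac12M(s)\dot s^2-V(s)$ for some smooth $M:[\mathbb{R}]_T\to(0,\infty)$, $V:[\mathbb{R}]_T\to\mathbb{R}$. *)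

theory Defs
  imports "HOL-Analysis.Analysis" "HOL-Library.Real_Mod" "HOL-Library.Periodic_Fun"
begin

text \<open>Smoothness means \<open>C\<^sup>\<infinity>\<close> on the whole space: \<open>f\<close> is \<open>C\<^sup>n\<^sup>+\<^sup>1\<close> if it is
  (Frechet) differentiable everywhere and all its directional derivatives are \<open>C\<^sup>n\<close>.\<close>

fun Ck :: "nat \<Rightarrow> ('a::real_normed_vector \<Rightarrow> 'b::real_normed_vector) \<Rightarrow> bool" where
  "Ck 0 f \<longleftrightarrow> continuous_on UNIV f"
| "Ck (Suc n) f \<longleftrightarrow> (\<forall>x. f differentiable at x) \<and>
     (\<forall>u. Ck n (\<lambda>x. frechet_derivative f (at x) u))"

definition smooth :: "('a::real_normed_vector \<Rightarrow> 'b::real_normed_vector) \<Rightarrow> bool" where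
  "smooth f \<longleftrightarrow> (\<forall>n. Ck n f)"

text \<open>The circle of reals modulo \<open>T\<close>, as the set of congruence classes, with its projection.
  Functions on it are total functions on \<^typ>\<open>real set\<close> whose values outside
  \<open>circle T\<close> are irrelevant.\<close>

definition mod_rel :: "real \<Rightarrow> (real \<times> real) set" where
  "mod_rel T = {(x, y). [x = y] (rmod T)}"

definition circle :: "real \<Rightarrow> real set set" where
  "circle T = UNIV // mod_rel T"

definition proj :: "real \<Rightarrow> real \<Rightarrow> real set" where
  "proj T x = mod_rel T `` {x}"

text \<open>For \<open>T > 0\<close> the projection is a covering and local diffeomorphism (its local inverses are the
  charts of the circle), so a function on the circle is smooth iff its pull-back to the line is. Its
  differential identifies the tangent bundle with \<open>circle T \<times> UNIV\<close>, for which the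
  corresponding projection from the plane plays the same role.\<close>

definition smooth_circle :: "real \<Rightarrow> (real set \<Rightarrow> real) \<Rightarrow> bool" where
  "smooth_circle T f \<longleftrightarrow> smooth (f \<circ> proj T)"

definition tangent_bundle :: "real \<Rightarrow> (real set \<times> real) set" where
  "tangent_bundle T = circle T \<times> UNIV"

definition smooth_tangent_bundle :: "real \<Rightarrow> (real set \<times> real \<Rightarrow> real) \<Rightarrow> bool" where
  "smooth_tangent_bundle T L \<longleftrightarrow> smooth (\<lambda>(x, w). L (proj T x, w))"

text \<open>The partial derivative in \<open>s\<close> is taken in the coordinate \<open>x\<close> with \<open>s = proj T x\<close>;
  it does not depend on the representative \<open>x\<close> because \<open>proj T\<close> is \<open>T\<close>-periodic.\<close>

definition partial_s :: "real \<Rightarrow> (real set \<times> real \<Rightarrow> real) \<Rightarrow> real set \<times> real \<Rightarrow> real" where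
  "partial_s T L = (\<lambda>(s, w). deriv (\<lambda>x. L (proj T x, w)) (SOME x. proj T x = s))"

definition partial_v :: "(real set \<times> real \<Rightarrow> real) \<Rightarrow> real set \<times> real \<Rightarrow> real" where
  "partial_v L = (\<lambda>(s, w). deriv (\<lambda>u. L (s, u)) w)"

text \<open>The curve \<open>s\<close> on the circle has velocity \<open>w\<close> at time \<open>t\<close>: near \<open>t\<close> it is represented by
  a real function \<open>x\<close> with derivative \<open>w\<close> at \<open>t\<close>.\<close>

definition has_velocity :: "real \<Rightarrow> (real \<Rightarrow> real set) \<Rightarrow> real \<Rightarrow> real \<Rightarrow> bool" where
  "has_velocity T s w t \<longleftrightarrow>
     (\<exists>x. (\<forall>\<^sub>F \<tau> in nhds t. s \<tau> = proj T (x \<tau>)) \<and> (x has_real_derivative w) (at t))"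

text \<open>A solution is a curve \<open>(s, v)\<close> in the tangent bundle, with \<open>v\<close> the velocity of \<open>s\<close>, on
  a nonempty open interval \<open>I\<close>; the values of \<open>s\<close> and \<open>v\<close> outside \<open>I\<close> are irrelevant.\<close>

definition solution_on ::
  "real \<Rightarrow> (real set \<Rightarrow> real) \<Rightarrow> (real set \<Rightarrow> real) \<Rightarrow>
    real set \<Rightarrow> (real \<Rightarrow> real set) \<Rightarrow> (real \<Rightarrow> real) \<Rightarrow> bool" where
  "solution_on T \<Psi>1 \<Psi>2 I s v \<longleftrightarrow> I \<noteq> {} \<and> open I \<and> is_interval I \<and>
     (\<forall>t\<in>I. s t \<in> circle T \<and> has_velocity T s (v t) t \<and>
       (v has_real_derivative \<Psi>1 (s t) + \<Psi>2 (s t) * (v t)\<^sup>2) (at t))"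

definition maximal_solution_on ::
  "real \<Rightarrow> (real set \<Rightarrow> real) \<Rightarrow> (real set \<Rightarrow> real) \<Rightarrow>
    real set \<Rightarrow> (real \<Rightarrow> real set) \<Rightarrow> (real \<Rightarrow> real) \<Rightarrow> bool" where
  "maximal_solution_on T \<Psi>1 \<Psi>2 I s v \<longleftrightarrow> solution_on T \<Psi>1 \<Psi>2 I s v \<and>
     (\<forall>J s' v'. solution_on T \<Psi>1 \<Psi>2 J s' v' \<and> I \<subseteq> J \<and>
        (\<forall>t\<in>I. s' t = s t \<and> v' t = v t) \<longrightarrow> J = I)"

definition EL_with ::
  "real \<Rightarrow> (real set \<Rightarrow> real) \<Rightarrow> (real set \<Rightarrow> real) \<Rightarrow> (real set \<times> real \<Rightarrow> real) \<Rightarrow> bool" where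
  "EL_with T \<Psi>1 \<Psi>2 L \<longleftrightarrow>
     smooth_tangent_bundle T L \<and>
     (\<forall>p\<in>tangent_bundle T. partial_v (partial_v L) p > 0) \<and>
     (\<forall>I s v. maximal_solution_on T \<Psi>1 \<Psi>2 I s v \<longrightarrow>
        (\<forall>t\<in>I. \<exists>D. ((\<lambda>\<tau>. partial_v L (s \<tau>, v \<tau>)) has_real_derivative D) (at t) \<and>
          D - partial_s T L (s t, v t) = 0))"

definition EL :: "real \<Rightarrow> (real set \<Rightarrow> real) \<Rightarrow> (real set \<Rightarrow> real) \<Rightarrow> bool" where
  "EL T \<Psi>1 \<Psi>2 \<longleftrightarrow> (\<exists>L. EL_with T \<Psi>1 \<Psi>2 L)"

definition mech_lagrangian ::
  "(real set \<Rightarrow> real) \<Rightarrow> (real set \<Rightarrow> real) \<Rightarrow> real set \<times> real \<Rightarrow> real" where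
  "mech_lagrangian M V = (\<lambda>(s, w). 1 / 2 * M s * w\<^sup>2 - V s)"

definition mechanical :: "real \<Rightarrow> (real set \<Rightarrow> real) \<Rightarrow> (real set \<Rightarrow> real) \<Rightarrow> bool" where
  "mechanical T \<Psi>1 \<Psi>2 \<longleftrightarrow> (\<exists>M V. M \<in> circle T \<rightarrow> {0<..} \<and> smooth_circle T M \<and>
     smooth_circle T V \<and> EL_with T \<Psi>1 \<Psi>2 (mech_lagrangian M V))"

definition virtual_mass :: "real \<Rightarrow> (real set \<Rightarrow> real) \<Rightarrow> real \<Rightarrow> real" where
  "virtual_mass T \<Psi>2 x = exp (- 2 * (LBINT \<tau>=0..x. (\<Psi>2 \<circ> proj T) \<tau>))"

definition virtual_potential ::
  "real \<Rightarrow> (real set \<Rightarrow> real) \<Rightarrow> (real set \<Rightarrow> real) \<Rightarrow> real \<Rightarrow> real" where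
  "virtual_potential T \<Psi>1 \<Psi>2 x = - (LBINT \<tau>=0..x. (\<Psi>1 \<circ> proj T) \<tau> * virtual_mass T \<Psi>2 \<tau>)"

end

theory Submission
  imports Defs
begin

text \<open>
  If the virtual mass \<open>M\<close> and virtual potential \<open>V\<close> are periodic, they descend to the circle, and a
  direct computation shows that the Euler-Lagrange equation of \<open>1/2 M w\<^sup>2 - V\<close> is \<open>M\<close> times the
  given equation (\<open>EL_with_mech_lagrangian\<close>). Mechanical systems are Euler-Lagrange by definition.

  The remaining implication, from Euler-Lagrange to periodicity, compares two first integrals. On the
  line, \<open>1/2 M w\<^sup>2 + V\<close> is constant along solutions. On the tangent bundle of the circle, the energy
  \<open>w L\<^sub>w - L\<close> of the Lagrangian \<open>L\<close> is constant along solutions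
  (\<open>lagrangian_energy_conserved\<close>), and since its derivative in \<open>w\<close> is \<open>w L\<^sub>w\<^sub>w\<close>, it is strictly
  increasing in \<open>w > 0\<close> (\<open>lagrangian_energy_strict_mono\<close>). For every large enough \<open>e\<close> the orbit
  \<open>w = sqrt (2 (e - V) / M)\<close> runs from \<open>x = 0\<close> to \<open>x = T\<close>, which is the same point of the circle;
  conservation and strict monotonicity of the energy force \<open>w\<close> to be the same at both ends. As
  \<open>M 0 = 1\<close> and \<open>V 0 = 0\<close>, this says \<open>e - V T = M T * e\<close> (\<open>rotating_orbit_velocity\<close>). Since
  this holds for all large \<open>e\<close>, \<open>M T = 1\<close> and \<open>V T = 0\<close>, and periodicity follows from the
  differential equations that \<open>M\<close> and \<open>V\<close> satisfy.

  The orbit is obtained by separation of variables (\<open>autonomous_ode_solution\<close>). The Euler-Lagrange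
  equation is only required along maximal solutions, so the orbit is first extended to one by Zorn's
  lemma (\<open>solution_extends_to_maximal\<close>).
\<close>

section \<open>Calculus of smooth functions\<close>

lemma Ck_Suc_imp_Ck: "Ck (Suc n) f \<Longrightarrow> Ck n f"
proof (induction n arbitrary: f)
  case 0
  then show ?case
    by (auto simp: continuous_on_eq_continuous_at intro: differentiable_imp_continuous_within)
qed auto

lemma Ck_const: "Ck n (\<lambda>x. c)"
  by (induction n arbitrary: c) auto

lemma Ck_add:
  assumes "Ck n f" "Ck n g"
  shows "Ck n (\<lambda>x. f x + g x)"
  using assms
proof (induction n arbitrary: f g)
  case 0
  then show ?case by (auto intro: continuous_on_add)
next
  case (Suc n)
  have D: "((\<lambda>x. f x + g x) has_derivative
      (\<lambda>u. frechet_derivative f (at x) u + frechet_derivative g (at x) u)) (at x)" for x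
    using Suc.prems by (intro has_derivative_add) (auto simp: frechet_derivative_works)
  have "Ck n (\<lambda>x. frechet_derivative f (at x) u + frechet_derivative g (at x) u)" for u
    using Suc.prems by (intro Suc.IH) auto
  then show ?case
    using D by (auto simp: frechet_derivative_at[OF D, symmetric] differentiable_def)
qed

lemma Ck_mult:
  fixes f g :: "'a::real_normed_vector \<Rightarrow> real"
  assumes "Ck n f" "Ck n g"
  shows "Ck n (\<lambda>x. f x * g x)"
  using assms
proof (induction n arbitrary: f g)
  case 0
  then show ?case by (auto intro: continuous_on_mult)
next
  case (Suc n)
  have diff: "f differentiable at x" "g differentiable at x" for x
    using Suc.prems by auto
  have D: "((\<lambda>x. f x * g x) has_derivative
      (\<lambda>u. f x * frechet_derivative g (at x) u + frechet_derivative f (at x) u * g x)) (at x)" for x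
    using diff[of x] by (intro has_derivative_mult) (auto simp: frechet_derivative_works)
  have "Ck n (\<lambda>x. f x * frechet_derivative g (at x) u + frechet_derivative f (at x) u * g x)" for u
    using Suc.prems by (intro Ck_add Suc.IH) (auto intro: Ck_Suc_imp_Ck)
  then show ?case
    using D by (auto simp: frechet_derivative_at[OF D, symmetric] differentiable_def)
qed

lemma Ck_compose_linear:
  fixes f :: "'b::real_normed_vector \<Rightarrow> 'c::real_normed_vector"
    and A :: "'a::real_normed_vector \<Rightarrow> 'b"
  assumes "Ck n f" "bounded_linear A"
  shows "Ck n (\<lambda>x. f (A x))"
  using assms(1)
proof (induction n arbitrary: f)
  case 0
  then show ?case
    using linear_continuous_on[OF assms(2)] by (auto intro: continuous_on_compose2)
next
  case (Suc n)
  have D: "((\<lambda>x. f (A x)) has_derivative (\<lambda>u. frechet_derivative f (at (A x)) (A u))) (at x)" for x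
    using Suc.prems bounded_linear_imp_has_derivative[OF assms(2)]
    by (intro has_derivative_compose[of A A x UNIV f]) (auto simp: frechet_derivative_works)
  have "Ck n (\<lambda>x. frechet_derivative f (at (A x)) (A u))" for u
    using Suc.prems by (intro Suc.IH[of "\<lambda>y. frechet_derivative f (at y) (A u)"]) auto
  then show ?case
    using D by (auto simp: frechet_derivative_at[OF D, symmetric] differentiable_def)
qed

lemma Ck_linear:
  assumes "bounded_linear A"
  shows "Ck n A"
proof (cases n)
  case 0
  then show ?thesis using linear_continuous_on[OF assms] by simp
next
  case (Suc m)
  have D: "(A has_derivative A) (at x)" for x
    by (rule bounded_linear_imp_has_derivative[OF assms])
  then show ?thesis
    using Suc D by (auto simp: frechet_derivative_at[OF D, symmetric] differentiable_def Ck_const)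
qed

lemma Ck_Suc_real:
  fixes f f' :: "real \<Rightarrow> real"
  assumes f: "\<And>x. (f has_real_derivative f' x) (at x)" and f': "Ck n f'"
  shows "Ck (Suc n) f"
proof -
  have D: "(f has_derivative (\<lambda>u. f' x * u)) (at x)" for x
    using f[of x] by (simp add: has_field_derivative_def)
  show ?thesis
    using D f' by (auto simp: frechet_derivative_at[OF D, symmetric] differentiable_def
        intro!: Ck_mult Ck_const)
qed

lemma smooth_imp_has_derivative:
  "smooth f \<Longrightarrow> (f has_derivative frechet_derivative f (at x)) (at x)"
  unfolding smooth_def using Ck.simps(2)[of 0 f] by (auto simp: frechet_derivative_works)

lemma smooth_directional:
  "smooth f \<Longrightarrow> smooth (\<lambda>x. frechet_derivative f (at x) u)"
  unfolding smooth_def using Ck.simps(2)[of _ f] by blast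

lemma smooth_imp_continuous: "smooth f \<Longrightarrow> continuous_on UNIV f"
  unfolding smooth_def using Ck.simps(1) by blast

section \<open>The circle and its tangent bundle\<close>

lemma proj_eq_iff: "proj T x = proj T y \<longleftrightarrow> (\<exists>n. y = x + of_int n * T)"
proof -
  have "proj T x = proj T y \<longleftrightarrow> [x = y] (rmod T)"
    unfolding proj_def mod_rel_def by (auto dest: rcong_sym rcong_trans)
  then show ?thesis by (simp add: rcong_altdef)
qed

lemma proj_in_circle: "proj T x \<in> circle T"
  unfolding proj_def circle_def by (auto intro: quotientI)

lemma circleE:
  assumes "s \<in> circle T"
  obtains x where "s = proj T x"
  using assms unfolding circle_def proj_def quotient_def by auto

lemma proj_plus_period: "proj T (x + T) = proj T x"
proof -
  have "proj T x = proj T (x + T)"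
    unfolding proj_eq_iff by (rule exI[of _ 1]) simp
  then show ?thesis by simp
qed

text \<open>The chosen representative in \<^const>\<open>partial_s\<close> may be replaced by any other one.\<close>

lemma partial_s_proj: "partial_s T L (proj T x, w) = deriv (\<lambda>y. L (proj T y, w)) x"
proof -
  define z where "z = (SOME y. proj T y = proj T x)"
  have "proj T z = proj T x"
    unfolding z_def by (rule someI) simp
  then obtain n where n: "z = x + of_int n * T"
    using proj_eq_iff[of T x z] by auto
  have shift: "proj T (y + of_int n * T) = proj T y" for y
    using proj_eq_iff[of T y "y + of_int n * T"] by auto
  have "((\<lambda>y. L (proj T y, w)) has_real_derivative D) (at z) \<longleftrightarrow>
      ((\<lambda>y. L (proj T y, w)) has_real_derivative D) (at x)" for D
    unfolding n DERIV_shift by (simp add: shift)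
  then show ?thesis
    unfolding partial_s_def deriv_def by (simp add: z_def[symmetric])
qed

text \<open>For a smooth function on the tangent bundle, \<^const>\<open>partial_s\<close> and \<^const>\<open>partial_v\<close> are the
  components of the derivative \<open>dL\<close> of its pull-back to the plane.\<close>

lemma smooth_tangent_bundle_partials:
  assumes "smooth_tangent_bundle T L"
  defines "dL \<equiv> frechet_derivative (\<lambda>(x, w). L (proj T x, w))"
  shows "((\<lambda>(x, w). L (proj T x, w)) has_derivative dL (at p)) (at p)"
    and "partial_s T L (proj T x, w) = dL (at (x, w)) (1, 0)"
    and "((\<lambda>u. L (proj T x, u)) has_real_derivative partial_v L (proj T x, w)) (at w)"
    and "partial_v L (proj T x, w) = dL (at (x, w)) (0, 1)"
    and "((\<lambda>u. partial_v L (proj T x, u)) has_real_derivative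
      partial_v (partial_v L) (proj T x, w)) (at w)"
proof -
  let ?l = "\<lambda>(x, w). L (proj T x, w)"
  have smooth: "smooth ?l"
    using assms(1) by (simp add: smooth_tangent_bundle_def)
  show D: "(?l has_derivative dL (at p)) (at p)" for p
    unfolding dL_def by (rule smooth_imp_has_derivative[OF smooth])
  have vert: "((\<lambda>u. f (x, u)) has_real_derivative f' (0, 1)) (at w)"
    if "(f has_derivative f') (at (x, w))" for f :: "real \<times> real \<Rightarrow> real" and f' x w
  proof -
    have "((\<lambda>u. f (x, u)) has_derivative (\<lambda>h. f' (0, h))) (at w)"
      by (rule has_derivative_compose[of "\<lambda>u. (x, u)" "\<lambda>h. (0, h)" w UNIV f])
        (intro has_derivative_Pair has_derivative_ident has_derivative_const that)+
    then show ?thesis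
    proof (rule has_derivative_imp_has_field_derivative)
      show "h * f' (0, 1) = f' (0, h)" for h
        using linear_scale[OF has_derivative_linear[OF that], of h "(0, 1)"] by simp
    qed
  qed
  have "((\<lambda>y. L (proj T y, w)) has_derivative (\<lambda>h. dL (at (x, w)) (h, 0))) (at x)"
  proof -
    have "((\<lambda>y. (y, w)) has_derivative (\<lambda>h. (h, 0))) (at x)"
      by (rule has_derivative_Pair[OF has_derivative_ident has_derivative_const])
    from has_derivative_compose[OF this, of ?l "dL (at (x, w))"] show ?thesis
      using D[of "(x, w)"] by simp
  qed
  then have "((\<lambda>y. L (proj T y, w)) has_real_derivative dL (at (x, w)) (1, 0)) (at x)"
  proof (rule has_derivative_imp_has_field_derivative)
    show "h * dL (at (x, w)) (1, 0) = dL (at (x, w)) (h, 0)" for h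
      using linear_scale[OF has_derivative_linear[OF D], of "(x, w)" h "(1, 0)"] by simp
  qed
  then show "partial_s T L (proj T x, w) = dL (at (x, w)) (1, 0)"
    unfolding partial_s_proj by (rule DERIV_imp_deriv)
  have v: "((\<lambda>u. L (proj T x, u)) has_real_derivative dL (at (x, w)) (0, 1)) (at w)" for x w
    using vert[OF D] by simp
  show pv: "partial_v L (proj T x, w) = dL (at (x, w)) (0, 1)" for x w
    unfolding partial_v_def using DERIV_imp_deriv[OF v] by simp
  then show "((\<lambda>u. L (proj T x, u)) has_real_derivative partial_v L (proj T x, w)) (at w)"
    using v by simp
  have "smooth (\<lambda>p. dL (at p) (0, 1))"
    unfolding dL_def by (rule smooth_directional[OF smooth])
  then have "((\<lambda>u. dL (at (x, u)) (0, 1)) has_real_derivative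
      frechet_derivative (\<lambda>p. dL (at p) (0, 1)) (at (x, w)) (0, 1)) (at w)"
    using vert[OF smooth_imp_has_derivative] by blast
  then have *: "((\<lambda>u. partial_v L (proj T x, u)) has_real_derivative
      frechet_derivative (\<lambda>p. dL (at p) (0, 1)) (at (x, w)) (0, 1)) (at w)"
    by (simp add: pv)
  then show "((\<lambda>u. partial_v L (proj T x, u)) has_real_derivative
      partial_v (partial_v L) (proj T x, w)) (at w)"
    using DERIV_imp_deriv[OF *] by (simp add: partial_v_def[of "partial_v L"])
qed

section \<open>Solutions\<close>

lemma solution_on_cong:
  assumes "\<And>t. t \<in> I \<Longrightarrow> s t = s' t \<and> v t = v' t" "open I" "t \<in> I"
  shows "has_velocity T s (v t) t \<longleftrightarrow> has_velocity T s' (v' t) t"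
    and "(v has_real_derivative D) (at t) \<longleftrightarrow> (v' has_real_derivative D) (at t)"
proof -
  have ev: "\<forall>\<^sub>F \<tau> in nhds t. s \<tau> = s' \<tau> \<and> v \<tau> = v' \<tau>"
    using assms by (auto simp: eventually_nhds)
  have "(\<forall>\<^sub>F \<tau> in nhds t. s \<tau> = proj T (x \<tau>)) \<longleftrightarrow> (\<forall>\<^sub>F \<tau> in nhds t. s' \<tau> = proj T (x \<tau>))" for x
    using ev by (intro eventually_subst) (auto elim: eventually_mono)
  then show "has_velocity T s (v t) t \<longleftrightarrow> has_velocity T s' (v' t) t"
    unfolding has_velocity_def using assms by auto
  show "(v has_real_derivative D) (at t) \<longleftrightarrow> (v' has_real_derivative D) (at t)"
    using ev by (intro DERIV_cong_ev) (auto elim: eventually_mono)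
qed

text \<open>Extensions of a solution are ordered by inclusion of graphs. The union of a chain is again
  the graph of a solution because the equation is local in time; uniqueness of solutions plays
  no role.\<close>

lemma solution_extends_to_maximal:
  assumes sol: "solution_on T \<Psi>1 \<Psi>2 I0 s0 v0"
  obtains I s v where "maximal_solution_on T \<Psi>1 \<Psi>2 I s v" "I0 \<subseteq> I"
    "\<And>t. t \<in> I0 \<Longrightarrow> s t = s0 t \<and> v t = v0 t"
proof -
  define graph where "graph I s v = (\<lambda>t. (t, s t, v t)) ` I"
    for I :: "real set" and s :: "real \<Rightarrow> real set" and v :: "real \<Rightarrow> real"
  have graph_mono: "graph I s v \<subseteq> graph J s' v' \<longleftrightarrow>
      I \<subseteq> J \<and> (\<forall>t\<in>I. s' t = s t \<and> v' t = v t)" for I J s v s' v'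
    unfolding graph_def by auto
  define S where "S = {G. graph I0 s0 v0 \<subseteq> G \<and>
    (\<exists>I s v. solution_on T \<Psi>1 \<Psi>2 I s v \<and> G = graph I s v)}"
  have chain: "\<Union>C \<in> S" if C: "C \<noteq> {}" "subset.chain S C" for C
  proof -
    have CS: "C \<subseteq> S" and lin: "\<And>X Y. X \<in> C \<Longrightarrow> Y \<in> C \<Longrightarrow> X \<subseteq> Y \<or> Y \<subseteq> X"
      using C(2) by (auto simp: subset_chain_def)
    then have "\<forall>X\<in>C. \<exists>I s v. solution_on T \<Psi>1 \<Psi>2 I s v \<and> X = graph I s v"
      by (auto simp: S_def)
    then obtain J a b where J: "\<And>X. X \<in> C \<Longrightarrow> solution_on T \<Psi>1 \<Psi>2 (J X) (a X) (b X)"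
      and X: "\<And>X. X \<in> C \<Longrightarrow> X = graph (J X) (a X) (b X)"
      by metis
    have I0_sub: "I0 \<subseteq> J X" if "X \<in> C" for X
      using CS X[OF that] that graph_mono[of I0 s0 v0 "J X" "a X" "b X"] by (auto simp: S_def)
    have agree: "a X t = a Y t \<and> b X t = b Y t"
      if "X \<in> C" "Y \<in> C" "t \<in> J X" "t \<in> J Y" for X Y t
      using lin[OF that(1,2)] X[OF that(1)] X[OF that(2)] that(3,4)
        graph_mono[of "J X" "a X" "b X" "J Y" "a Y" "b Y"]
        graph_mono[of "J Y" "a Y" "b Y" "J X" "a X" "b X"] by metis
    define I where "I = \<Union>(J ` C)"
    define s where "s t = a (SOME X. X \<in> C \<and> t \<in> J X) t" for t
    define v where "v t = b (SOME X. X \<in> C \<and> t \<in> J X) t" for t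
    have sv: "s t = a X t \<and> v t = b X t" if "X \<in> C" "t \<in> J X" for X t
    proof -
      have "(SOME X. X \<in> C \<and> t \<in> J X) \<in> C \<and> t \<in> J (SOME X. X \<in> C \<and> t \<in> J X)"
        by (rule someI[of "\<lambda>X. X \<in> C \<and> t \<in> J X" X]) (use that in auto)
      then show ?thesis
        unfolding s_def v_def using agree that by blast
    qed
    have I0: "I0 \<noteq> {}"
      using sol by (auto simp: solution_on_def)
    have "connected I"
      unfolding I_def
    proof (rule connected_Union)
      show "connected A" if "A \<in> J ` C" for A
        using that J by (auto simp: solution_on_def is_interval_connected_1)
      show "\<Inter>(J ` C) \<noteq> {}"
        using I0 I0_sub by blast
    qed
    moreover have "open I"
      unfolding I_def using J by (auto simp: solution_on_def)
    moreover have "I \<noteq> {}"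
      using I0 I0_sub C(1) by (auto simp: I_def)
    moreover have "s t \<in> circle T \<and> has_velocity T s (v t) t \<and>
       (v has_real_derivative \<Psi>1 (s t) + \<Psi>2 (s t) * (v t)\<^sup>2) (at t)" if t: "t \<in> I" for t
    proof -
      obtain X where X': "X \<in> C" "t \<in> J X"
        using t by (auto simp: I_def)
      have "open (J X)" "a X t \<in> circle T" "has_velocity T (a X) (b X t) t"
        "(b X has_real_derivative \<Psi>1 (a X t) + \<Psi>2 (a X t) * (b X t)\<^sup>2) (at t)"
        using J[OF X'(1)] X'(2) by (auto simp: solution_on_def)
      then show ?thesis
        using solution_on_cong[of "J X" s "a X" v "b X" t] sv X' by auto
    qed
    ultimately have sol_I: "solution_on T \<Psi>1 \<Psi>2 I s v"
      by (auto simp: solution_on_def is_interval_connected_1)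
    have "graph I s v = (\<Union>X\<in>C. graph (J X) (a X) (b X))"
      using sv unfolding graph_def I_def by (auto simp: image_iff)
    then have U: "\<Union>C = graph I s v"
      using X by auto
    have "graph I0 s0 v0 \<subseteq> \<Union>C"
      using C(1) CS by (auto simp: S_def)
    with sol_I U show ?thesis
      unfolding S_def by blast
  qed
  have "S \<noteq> {}"
    using sol by (auto simp: S_def)
  then have "\<exists>G\<in>S. \<forall>X\<in>S. G \<subseteq> X \<longrightarrow> X = G"
    using chain by (rule subset_Zorn_nonempty)
  then obtain G where G: "G \<in> S" "\<And>X. X \<in> S \<Longrightarrow> G \<subseteq> X \<Longrightarrow> X = G"
    by auto
  then obtain I s v where ext: "graph I0 s0 v0 \<subseteq> graph I s v"
    and sol_I: "solution_on T \<Psi>1 \<Psi>2 I s v" and GI: "G = graph I s v"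
    by (auto simp: S_def)
  have "J = I" if "solution_on T \<Psi>1 \<Psi>2 J s' v'" "I \<subseteq> J"
    "\<forall>t\<in>I. s' t = s t \<and> v' t = v t" for J s' v'
  proof -
    have le: "graph I s v \<subseteq> graph J s' v'"
      using that by (simp add: graph_mono)
    then have "graph J s' v' = graph I s v"
      using G(2)[of "graph J s' v'"] that(1) ext GI by (auto simp: S_def)
    then show ?thesis
      using graph_mono[of J s' v' I s v] that(2) by auto
  qed
  then have "maximal_solution_on T \<Psi>1 \<Psi>2 I s v"
    using sol_I unfolding maximal_solution_on_def by blast
  then show ?thesis
    using that[of I s v] ext graph_mono[of I0 s0 v0 I s v] by auto
qed

text \<open>Separation of variables: \<^term>\<open>x\<close> is the inverse of a primitive of \<^term>\<open>1 / w\<close>.\<close>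

lemma autonomous_ode_solution:
  fixes w :: "real \<Rightarrow> real"
  assumes cont: "continuous_on {a<..<b} w" and pos: "\<And>y. y \<in> {a<..<b} \<Longrightarrow> w y > 0" and "a < b"
  obtains I x where "open I" "is_interval I" "x ` I = {a<..<b}"
    "\<And>t. t \<in> I \<Longrightarrow> (x has_real_derivative w (x t)) (at t)"
proof -
  let ?J = "{a<..<b}"
  obtain G where G: "\<And>y. y \<in> ?J \<Longrightarrow> (G has_real_derivative 1 / w y) (at y)"
  proof -
    have "\<exists>G. \<forall>y::real. ereal a < y \<longrightarrow> y < ereal b \<longrightarrow> (G has_vector_derivative 1 / w y) (at y)"
    proof (rule einterval_antiderivative)
      show "isCont (\<lambda>y. 1 / w y) y" if "ereal a < y" "y < ereal b" for y
      proof -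
        have "y \<in> ?J" using that by simp
        then have "isCont w y" "w y \<noteq> 0"
          using cont pos[of y] by (auto simp: continuous_on_eq_continuous_at)
        then show ?thesis by (intro continuous_intros)
      qed
    qed (use \<open>a < b\<close> in auto)
    then show thesis
      using that by (auto simp: has_real_derivative_iff_has_vector_derivative)
  qed
  have contG: "continuous_on ?J G"
    using G by (meson DERIV_isCont continuous_at_imp_continuous_on)
  have less: "G y < G z" if "y \<in> ?J" "z \<in> ?J" "y < z" for y z
  proof (rule DERIV_pos_imp_increasing[OF \<open>y < z\<close>])
    show "\<exists>D. (G has_real_derivative D) (at u) \<and> D > 0" if "y \<le> u" "u \<le> z" for u
      using G[of u] pos[of u] that \<open>y \<in> ?J\<close> \<open>z \<in> ?J\<close> by (intro exI[of _ "1 / w u"]) auto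
  qed
  then have inj: "inj_on G ?J"
    by (intro linorder_inj_onI') (metis less_irrefl)+
  define x where "x = inv_into ?J G"
  have xG: "x (G y) = y" if "y \<in> ?J" for y
    using inj that by (simp add: x_def)
  have openI: "open (G ` ?J)"
    using invariance_of_domain_gen[of ?J G] contG inj by simp
  have "continuous_on (G ` ?J) x"
    using continuous_on_inverse_open[of ?J G x] contG xG by simp
  then have contx: "isCont x t" if "t \<in> G ` ?J" for t
    using that openI by (metis continuous_on_eq_continuous_at)
  have deriv: "(x has_real_derivative w (x t)) (at t)" if t: "t \<in> G ` ?J" for t
  proof -
    have xt: "x t \<in> ?J" "w (x t) > 0"
      using t xG pos by auto
    then have "(x has_real_derivative inverse (1 / w (x t))) (at t)"
      using has_field_derivative_inverse_basic[OF G[OF xt(1)] _ contx[OF t] openI t] xG by force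
    then show ?thesis by simp
  qed
  have "is_interval (G ` ?J)"
    unfolding is_interval_connected_1 using contG by (intro connected_continuous_image) auto
  moreover have "x ` G ` ?J = ?J"
    using xG by force
  ultimately show ?thesis
    using that openI deriv by blast
qed

section \<open>Virtual mass and virtual potential\<close>

lemma LBINT_has_real_derivative:
  fixes f :: "real \<Rightarrow> real"
  assumes "continuous_on UNIV f"
  shows "((\<lambda>x. LBINT y=0..x. f y) has_real_derivative f x) (at x)"
proof -
  let ?a = "- \<bar>x\<bar> - 1" and ?b = "\<bar>x\<bar> + 1"
  have "((\<lambda>u. LBINT y=ereal 0..u. f y) has_vector_derivative f x) (at x within {?a..?b})"
    by (rule interval_integral_FTC2) (use continuous_on_subset[OF assms] in auto)
  moreover have "at x within {?a..?b} = at x"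
    by (rule at_within_interior) auto
  ultimately show ?thesis
    by (simp add: has_real_derivative_iff_has_vector_derivative zero_ereal_def)
qed

lemma virtual_mass_has_derivative:
  assumes "smooth_circle T \<Psi>2"
  shows "(virtual_mass T \<Psi>2 has_real_derivative
    - 2 * \<Psi>2 (proj T x) * virtual_mass T \<Psi>2 x) (at x)"
proof -
  have *: "((\<lambda>x. exp (- 2 * (LBINT \<tau>=0..x. (\<Psi>2 \<circ> proj T) \<tau>))) has_real_derivative
     exp (- 2 * (LBINT \<tau>=0..x. (\<Psi>2 \<circ> proj T) \<tau>)) * (- 2 * (\<Psi>2 \<circ> proj T) x)) (at x)"
    using assms
    by (intro DERIV_fun_exp DERIV_cmult LBINT_has_real_derivative smooth_imp_continuous)
      (simp add: smooth_circle_def o_def)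
  have "virtual_mass T \<Psi>2 = (\<lambda>x. exp (- 2 * (LBINT \<tau>=0..x. (\<Psi>2 \<circ> proj T) \<tau>)))"
    by (simp add: fun_eq_iff virtual_mass_def)
  then show ?thesis
    using * by (simp add: mult.commute)
qed

lemma virtual_mass_pos: "virtual_mass T \<Psi>2 x > 0"
  by (simp add: virtual_mass_def)

lemma virtual_mass_0: "virtual_mass T \<Psi>2 0 = 1"
  by (simp add: virtual_mass_def flip: zero_ereal_def)

lemma smooth_virtual_mass:
  assumes "smooth_circle T \<Psi>2"
  shows "smooth (virtual_mass T \<Psi>2)"
  unfolding smooth_def
proof
  note D = virtual_mass_has_derivative[OF assms]
  show "Ck n (virtual_mass T \<Psi>2)" for n
  proof (induction n)
    case 0
    then show ?case
      using D by (auto simp: continuous_on_eq_continuous_at intro: DERIV_isCont)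
  next
    case (Suc n)
    moreover have "Ck n (\<lambda>x. \<Psi>2 (proj T x))"
      using assms by (simp add: smooth_circle_def smooth_def o_def)
    ultimately show ?case
      by (intro Ck_Suc_real[OF D] Ck_mult Ck_const)
  qed
qed

lemma virtual_potential_has_derivative:
  assumes "smooth_circle T \<Psi>1" "smooth_circle T \<Psi>2"
  shows "(virtual_potential T \<Psi>1 \<Psi>2 has_real_derivative
    - (\<Psi>1 (proj T x) * virtual_mass T \<Psi>2 x)) (at x)"
proof -
  have "continuous_on UNIV (\<lambda>x. (\<Psi>1 \<circ> proj T) x * virtual_mass T \<Psi>2 x)"
    using assms(1) smooth_virtual_mass[OF assms(2)]
    by (intro continuous_on_mult smooth_imp_continuous) (auto simp: smooth_circle_def o_def)
  from DERIV_minus[OF LBINT_has_real_derivative[OF this]] show ?thesis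
    by (simp add: virtual_potential_def[abs_def])
qed

lemma virtual_potential_0: "virtual_potential T \<Psi>1 \<Psi>2 0 = 0"
  by (simp add: virtual_potential_def flip: zero_ereal_def)

lemma smooth_virtual_potential:
  assumes "smooth_circle T \<Psi>1" "smooth_circle T \<Psi>2"
  shows "smooth (virtual_potential T \<Psi>1 \<Psi>2)"
  unfolding smooth_def
proof
  note D = virtual_potential_has_derivative[OF assms]
  fix n
  have "Ck n (\<lambda>x. \<Psi>1 (proj T x))" "Ck n (virtual_mass T \<Psi>2)"
    using assms(1) smooth_virtual_mass[OF assms(2)]
    by (auto simp: smooth_circle_def smooth_def o_def)
  then have "Ck n (\<lambda>x. - 1 * (\<Psi>1 (proj T x) * virtual_mass T \<Psi>2 x))"
    by (intro Ck_mult Ck_const)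
  then have "Ck (Suc n) (virtual_potential T \<Psi>1 \<Psi>2)"
    by (intro Ck_Suc_real[OF D]) simp
  then show "Ck n (virtual_potential T \<Psi>1 \<Psi>2)"
    by (rule Ck_Suc_imp_Ck)
qed

text \<open>The mass and the potential solve differential equations with periodic coefficients, so agreement at
  \<open>0\<close> and \<open>T\<close> propagates to all shifts by \<open>T\<close>.\<close>

lemma virtual_mass_periodic:
  assumes "smooth_circle T \<Psi>2" "virtual_mass T \<Psi>2 T = 1"
  shows "virtual_mass T \<Psi>2 (x + T) = virtual_mass T \<Psi>2 x"
proof -
  let ?M = "virtual_mass T \<Psi>2"
  note D = virtual_mass_has_derivative[OF assms(1)]
  have "((\<lambda>x. ?M (x + T) / ?M x) has_real_derivative 0) (at x)" for x
  proof -
    have "((\<lambda>x. ?M (x + T)) has_real_derivative - 2 * \<Psi>2 (proj T x) * ?M (x + T)) (at x)"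
      using D[of "x + T"] by (simp add: DERIV_shift proj_plus_period)
    from DERIV_divide[OF this D] virtual_mass_pos[of T \<Psi>2 x] show ?thesis
      by (simp add: mult_ac)
  qed
  then have "?M (x + T) / ?M x = ?M (0 + T) / ?M 0"
    by (intro DERIV_isconst_all[of "\<lambda>x. ?M (x + T) / ?M x"]) blast
  then show ?thesis
    using assms(2) virtual_mass_pos[of T \<Psi>2 x] by (simp add: virtual_mass_0)
qed

lemma virtual_potential_periodic:
  assumes "smooth_circle T \<Psi>1" "smooth_circle T \<Psi>2"
    and "virtual_mass T \<Psi>2 T = 1" "virtual_potential T \<Psi>1 \<Psi>2 T = 0"
  shows "virtual_potential T \<Psi>1 \<Psi>2 (x + T) = virtual_potential T \<Psi>1 \<Psi>2 x"
proof -
  let ?V = "virtual_potential T \<Psi>1 \<Psi>2"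
  note D = virtual_potential_has_derivative[OF assms(1,2)]
  have "((\<lambda>x. ?V (x + T) - ?V x) has_real_derivative 0) (at x)" for x
  proof -
    have "((\<lambda>x. ?V (x + T)) has_real_derivative - (\<Psi>1 (proj T x) * virtual_mass T \<Psi>2 x)) (at x)"
      using D[of "x + T"] virtual_mass_periodic[OF assms(2,3)]
      by (simp add: DERIV_shift proj_plus_period)
    from DERIV_diff[OF this D] show ?thesis by simp
  qed
  then have "?V (x + T) - ?V x = ?V (0 + T) - ?V 0"
    by (intro DERIV_isconst_all[of "\<lambda>x. ?V (x + T) - ?V x"]) blast
  then show ?thesis
    using assms(4) by (simp add: virtual_potential_0)
qed

section \<open>Euler-Lagrange systems have periodic mass and potential\<close>

text \<open>The energy \<open>w L\<^sub>w - L\<close> of a Lagrangian. It is a function on the tangent bundle itself, so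
  it takes equal values at \<open>(x, w)\<close> and \<open>(x + T, w)\<close>.\<close>

definition lagrangian_energy :: "(real set \<times> real \<Rightarrow> real) \<Rightarrow> real set \<times> real \<Rightarrow> real" where
  "lagrangian_energy L = (\<lambda>(s, w). w * partial_v L (s, w) - L (s, w))"

lemma lagrangian_energy_strict_mono:
  assumes "EL_with T \<Psi>1 \<Psi>2 L" "0 < w1" "w1 < w2"
  shows "lagrangian_energy L (proj T x, w1) < lagrangian_energy L (proj T x, w2)"
proof (rule DERIV_pos_imp_increasing[OF \<open>w1 < w2\<close>])
  fix w assume w: "w1 \<le> w" "w \<le> w2"
  have L: "smooth_tangent_bundle T L" and Lvv: "partial_v (partial_v L) (proj T x, w) > 0"
    using assms(1) by (auto simp: EL_with_def tangent_bundle_def proj_in_circle)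
  note D = smooth_tangent_bundle_partials(3,5)[OF L, of x w]
  have "((\<lambda>w. w * partial_v L (proj T x, w) - L (proj T x, w)) has_real_derivative
      w * partial_v (partial_v L) (proj T x, w)) (at w)"
    using DERIV_diff[OF DERIV_mult[OF DERIV_ident D(2)] D(1)] by (simp add: mult_ac)
  then show "\<exists>D. ((\<lambda>w. lagrangian_energy L (proj T x, w)) has_real_derivative D) (at w) \<and> D > 0"
    using Lvv w \<open>0 < w1\<close> by (auto simp: lagrangian_energy_def)
qed

lemma lagrangian_energy_conserved:
  assumes EL: "EL_with T \<Psi>1 \<Psi>2 L"
    and sol: "solution_on T \<Psi>1 \<Psi>2 I (\<lambda>t. proj T (x t)) v"
    and x: "\<And>t. t \<in> I \<Longrightarrow> (x has_real_derivative v t) (at t)"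
    and t: "t1 \<in> I" "t2 \<in> I"
  shows "lagrangian_energy L (proj T (x t1), v t1) = lagrangian_energy L (proj T (x t2), v t2)"
proof -
  let ?l = "\<lambda>(x, w). L (proj T x, w)"
  let ?dl = "\<lambda>p. frechet_derivative ?l (at p)"
  have L: "smooth_tangent_bundle T L"
    using EL by (simp add: EL_with_def)
  note partials = smooth_tangent_bundle_partials[OF L]
  have I: "open I" "convex I"
    using sol by (auto simp: solution_on_def is_interval_convex_1)
  \<comment> \<open>The Euler-Lagrange equation is only known along maximal solutions.\<close>
  obtain J s' v' where maximal: "maximal_solution_on T \<Psi>1 \<Psi>2 J s' v'" and "I \<subseteq> J"
    and ext: "\<And>t. t \<in> I \<Longrightarrow> s' t = proj T (x t) \<and> v' t = v t"
    using solution_extends_to_maximal[OF sol] by metis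
  let ?E = "\<lambda>t. lagrangian_energy L (proj T (x t), v t)"
  have "(?E has_real_derivative 0) (at t)" if t: "t \<in> I" for t
  proof -
    let ?p = "\<lambda>t. partial_v L (proj T (x t), v t)"
    let ?Ls = "partial_s T L (proj T (x t), v t)"
    obtain v_dot where v: "(v has_real_derivative v_dot) (at t)"
      using sol t by (auto simp: solution_on_def)
    have "((\<lambda>\<tau>. partial_v L (s' \<tau>, v' \<tau>)) has_real_derivative ?Ls) (at t)"
      using EL maximal t \<open>I \<subseteq> J\<close> ext[OF t] unfolding EL_with_def by fastforce
    then have p: "(?p has_real_derivative ?Ls) (at t)"
      using has_field_derivative_transform_within_open[OF _ \<open>open I\<close> t] ext by fastforce
    have "((\<lambda>t. ?l (x t, v t)) has_derivative (\<lambda>h. ?dl (x t, v t) (v t * h, v_dot * h))) (at t)"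
    proof -
      have "((\<lambda>t. (x t, v t)) has_derivative (\<lambda>h. (v t * h, v_dot * h))) (at t)"
        using x[OF t] v by (intro has_derivative_Pair) (auto simp: has_field_derivative_def)
      from has_derivative_compose[OF this partials(1)] show ?thesis .
    qed
    then have l: "((\<lambda>t. ?l (x t, v t)) has_real_derivative v t * ?Ls + v_dot * ?p t) (at t)"
    proof (rule has_derivative_imp_has_field_derivative)
      fix h
      have lin: "linear (?dl (x t, v t))"
        using has_derivative_linear[OF partials(1)] .
      have "(v t * h, v_dot * h) = (h * v t) *\<^sub>R (1, 0) + (h * v_dot) *\<^sub>R (0, 1)"
        by (simp add: mult_ac)
      then show "h * (v t * ?Ls + v_dot * ?p t) = ?dl (x t, v t) (v t * h, v_dot * h)"
        unfolding partials(2,4)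
        by (simp only: linear_add[OF lin] linear_scale[OF lin]) (simp add: algebra_simps)
    qed
    show ?thesis
      using DERIV_diff[OF DERIV_mult[OF v p] l]
      by (simp add: lagrangian_energy_def mult_ac)
  qed
  then show ?thesis
    using has_field_derivative_zero_constant[of I ?E] I t
    by (metis has_field_derivative_at_within)
qed

text \<open>For a level \<open>e\<close> above the virtual potential near \<open>[0, T]\<close>, the orbit with
  \<open>1/2 M w\<^sup>2 + V = e\<close> and \<open>w > 0\<close> runs once around the circle, from \<open>x = 0\<close> to \<open>x = T\<close>. Both ends
  are the same point of the circle and have the same Lagrangian energy, hence the same velocity. The margin
  of \<open>1\<close> around \<open>[0, T]\<close> lets the orbit pass both ends within an open time interval.\<close>

lemma rotating_orbit_velocity:
  fixes T e :: real
  assumes EL: "EL_with T \<Psi>1 \<Psi>2 L" and "T > 0"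
    and \<Psi>: "smooth_circle T \<Psi>1" "smooth_circle T \<Psi>2"
  defines "M \<equiv> virtual_mass T \<Psi>2" and "V \<equiv> virtual_potential T \<Psi>1 \<Psi>2"
  assumes e: "\<And>y. y \<in> {-1..T + 1} \<Longrightarrow> V y < e"
  shows "e - V T = M T * e"
proof -
  define Q where "Q y = 2 * (e - V y) / M y" for y
  define w where "w y = sqrt (Q y)" for y
  have M_pos: "M y > 0" for y
    by (simp add: M_def virtual_mass_pos)
  have Q_pos: "Q y > 0" if "y \<in> {-1..T + 1}" for y
    using e[OF that] M_pos[of y] by (simp add: Q_def)
  have w_pos: "w y > 0" and w_sq: "(w y)\<^sup>2 = Q y" if "y \<in> {-1..T + 1}" for y
    using Q_pos[OF that] by (auto simp: w_def)
  \<comment> \<open>The graph of \<^term>\<open>w\<close> is the orbit of level \<^term>\<open>e\<close>: \<open>w w' = \<Psi>1 + \<Psi>2 w\<^sup>2\<close>.\<close>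
  have Q_deriv: "(Q has_real_derivative 2 * (\<Psi>1 (proj T y) + \<Psi>2 (proj T y) * Q y)) (at y)" for y
  proof -
    have V: "(V has_real_derivative - (\<Psi>1 (proj T y) * M y)) (at y)"
      and M: "(M has_real_derivative - 2 * \<Psi>2 (proj T y) * M y) (at y)"
      unfolding V_def M_def
      by (intro virtual_potential_has_derivative virtual_mass_has_derivative \<Psi>)+
    have "((\<lambda>y. 2 * (e - V y) / M y) has_real_derivative
        (2 * (0 - - (\<Psi>1 (proj T y) * M y)) * M y
          - 2 * (e - V y) * (- 2 * \<Psi>2 (proj T y) * M y)) / (M y * M y)) (at y)"
      using M_pos[of y] by (intro DERIV_divide DERIV_cmult DERIV_diff DERIV_const V M) simp
    moreover have "(2 * (0 - - (\<Psi>1 (proj T y) * M y)) * M y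
          - 2 * (e - V y) * (- 2 * \<Psi>2 (proj T y) * M y)) / (M y * M y) =
        2 * (\<Psi>1 (proj T y) + \<Psi>2 (proj T y) * Q y)"
      using M_pos[of y] by (simp add: Q_def field_simps)
    ultimately show ?thesis
      by (simp add: Q_def[abs_def])
  qed
  have w_deriv: "(w has_real_derivative (\<Psi>1 (proj T y) + \<Psi>2 (proj T y) * (w y)\<^sup>2) / w y) (at y)"
    if y: "y \<in> {-1..T + 1}" for y
  proof -
    have "(w has_real_derivative inverse (w y) / 2 *
        (2 * (\<Psi>1 (proj T y) + \<Psi>2 (proj T y) * Q y))) (at y)"
      using DERIV_chain2[OF DERIV_real_sqrt[OF Q_pos[OF y]] Q_deriv] by (simp add: w_def[abs_def])
    then show ?thesis
      by (rule DERIV_cong) (use w_pos[OF y] w_sq[OF y] in \<open>simp add: field_simps\<close>)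
  qed
  have "continuous_on {-1<..<T + 1} w"
    by (intro continuous_at_imp_continuous_on ballI DERIV_isCont[OF w_deriv]) auto
  then obtain I x where I: "open I" "is_interval I" and onto: "x ` I = {-1<..<T + 1}"
    and x: "\<And>t. t \<in> I \<Longrightarrow> (x has_real_derivative w (x t)) (at t)"
    using autonomous_ode_solution[of "-1" "T + 1" w] w_pos \<open>T > 0\<close> by auto
  have "solution_on T \<Psi>1 \<Psi>2 I (\<lambda>t. proj T (x t)) (\<lambda>t. w (x t))"
    unfolding solution_on_def
  proof (intro conjI ballI)
    show "I \<noteq> {}"
      using onto \<open>T > 0\<close> by auto
    fix t assume t: "t \<in> I"
    then have "x t \<in> x ` I"
      by (rule imageI)
    then have xt: "x t \<in> {-1..T + 1}"
      by (simp add: onto)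
    show "has_velocity T (\<lambda>t. proj T (x t)) (w (x t)) t"
      unfolding has_velocity_def using x[OF t] by (intro exI[of _ x]) simp
    show "((\<lambda>t. w (x t)) has_real_derivative
        \<Psi>1 (proj T (x t)) + \<Psi>2 (proj T (x t)) * (w (x t))\<^sup>2) (at t)"
      using DERIV_chain2[OF w_deriv[OF xt] x[OF t]] w_pos[OF xt] by simp
  qed (use I proj_in_circle in auto)
  note conserved = lagrangian_energy_conserved[OF EL this x]
  have "0 \<in> x ` I" "T \<in> x ` I"
    using onto \<open>T > 0\<close> by auto
  then obtain t0 t1 where "t0 \<in> I" "x t0 = 0" "t1 \<in> I" "x t1 = T"
    by (metis imageE)
  then have "lagrangian_energy L (proj T 0, w 0) = lagrangian_energy L (proj T T, w T)"
    using conserved by metis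
  moreover have "proj T T = proj T 0"
    using proj_plus_period[of T 0] by simp
  ultimately have "\<not> w 0 < w T" "\<not> w T < w 0"
    using lagrangian_energy_strict_mono[OF EL, of "w 0" "w T" 0]
      lagrangian_energy_strict_mono[OF EL, of "w T" "w 0" 0] w_pos[of 0] w_pos[of T] \<open>T > 0\<close>
    by auto
  then have "Q 0 = Q T"
    by (simp add: w_def)
  then show ?thesis
    using M_pos[of T] by (simp add: Q_def M_def V_def virtual_mass_0 virtual_potential_0 field_simps)
qed

text \<open>The identity \<open>e - V T = M T * e\<close>, affine in \<open>e\<close>, holds for all large \<open>e\<close>, which determines its
  coefficients.\<close>

lemma EL_with_imp_trivial_holonomy:
  assumes EL: "EL_with T \<Psi>1 \<Psi>2 L" and "T > 0"
    and \<Psi>: "smooth_circle T \<Psi>1" "smooth_circle T \<Psi>2"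
  shows "virtual_mass T \<Psi>2 T = 1" "virtual_potential T \<Psi>1 \<Psi>2 T = 0"
proof -
  let ?M = "virtual_mass T \<Psi>2" and ?V = "virtual_potential T \<Psi>1 \<Psi>2"
  have "bounded (?V ` {-1..T + 1})"
    using continuous_on_subset[OF smooth_imp_continuous[OF smooth_virtual_potential[OF \<Psi>]]]
    by (intro compact_imp_bounded compact_continuous_image) auto
  then obtain B where B: "\<And>y. y \<in> {-1..T + 1} \<Longrightarrow> norm (?V y) \<le> B"
    unfolding bounded_iff by blast
  have rel: "e - ?V T = ?M T * e" if "e > B" for e
    by (rule rotating_orbit_velocity[OF EL \<open>T > 0\<close> \<Psi>]) (use B that in fastforce)
  have rel': "B + 1 - ?V T = ?M T * (B + 1)" "B + 2 - ?V T = ?M T * (B + 2)"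
    by (rule rel, simp)+
  then show "?M T = 1"
    by (simp add: algebra_simps)
  with rel' show "?V T = 0"
    by simp
qed

section \<open>The mechanical Lagrangian\<close>

text \<open>The Euler-Lagrange equation of \<open>1/2 M w\<^sup>2 - V\<close> is \<open>M\<close> times the given equation, because
  \<open>M' = -2 \<Psi>2 M\<close> and \<open>V' = -\<Psi>1 M\<close>.\<close>

lemma EL_with_mech_lagrangian:
  assumes \<Psi>: "smooth_circle T \<Psi>1" "smooth_circle T \<Psi>2"
    and M: "virtual_mass T \<Psi>2 = M \<circ> proj T"
    and V: "virtual_potential T \<Psi>1 \<Psi>2 = V \<circ> proj T"
  shows "EL_with T \<Psi>1 \<Psi>2 (mech_lagrangian M V)"
proof -
  let ?L = "mech_lagrangian M V"
  let ?M = "\<lambda>x. M (proj T x)" and ?V = "\<lambda>x. V (proj T x)"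
  have DM: "(?M has_real_derivative - 2 * \<Psi>2 (proj T x) * ?M x) (at x)" for x
    using virtual_mass_has_derivative[OF \<Psi>(2)] by (simp add: M o_def)
  have DV: "(?V has_real_derivative - (\<Psi>1 (proj T x) * ?M x)) (at x)" for x
    using virtual_potential_has_derivative[OF \<Psi>] by (simp add: M V o_def)
  have "smooth (\<lambda>p::real \<times> real. 1 / 2 * ?M (fst p) * (snd p * snd p) + - 1 * ?V (fst p))"
    unfolding smooth_def
  proof
    fix n
    have "Ck n ?M" "Ck n ?V"
      using smooth_virtual_mass[OF \<Psi>(2)] smooth_virtual_potential[OF \<Psi>]
      by (auto simp: M V smooth_def o_def)
    then have "Ck n (\<lambda>p::real \<times> real. ?M (fst p))" "Ck n (\<lambda>p::real \<times> real. ?V (fst p))"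
      by (auto intro: Ck_compose_linear bounded_linear_fst)
    moreover have "Ck n (\<lambda>p::real \<times> real. snd p)"
      by (rule Ck_linear[OF bounded_linear_snd])
    ultimately show "Ck n (\<lambda>p::real \<times> real. 1 / 2 * ?M (fst p) * (snd p * snd p) + - 1 * ?V (fst p))"
      by (intro Ck_add Ck_mult Ck_const)
  qed
  moreover have "(\<lambda>p::real \<times> real. 1 / 2 * ?M (fst p) * (snd p * snd p) + - 1 * ?V (fst p)) =
      (\<lambda>(x, w). ?L (proj T x, w))"
    by (auto simp: mech_lagrangian_def power2_eq_square)
  ultimately have smooth: "smooth_tangent_bundle T ?L"
    by (simp add: smooth_tangent_bundle_def)
  have Lv: "partial_v ?L (s, w) = M s * w" for s w
    unfolding partial_v_def mech_lagrangian_def prod.case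
    by (rule DERIV_imp_deriv) (auto intro!: derivative_eq_intros)
  have Lvv: "partial_v (partial_v ?L) (s, w) = M s" for s w
    unfolding partial_v_def[of "partial_v ?L"] prod.case Lv
    by (rule DERIV_imp_deriv) (auto intro!: derivative_eq_intros)
  have Ls: "partial_s T ?L (proj T x, w) = ?M x * (\<Psi>1 (proj T x) - \<Psi>2 (proj T x) * w\<^sup>2)" for x w
    unfolding partial_s_proj mech_lagrangian_def prod.case
    by (rule DERIV_imp_deriv)
      (auto intro!: derivative_eq_intros DM DV simp: algebra_simps)
  have pos: "M s > 0" if "s \<in> circle T" for s
    using that virtual_mass_pos[of T \<Psi>2] by (auto elim!: circleE simp: M)
  have "((\<lambda>\<tau>. partial_v ?L (s \<tau>, v \<tau>)) has_real_derivative partial_s T ?L (s t, v t)) (at t)"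
    if sol: "solution_on T \<Psi>1 \<Psi>2 I s v" "t \<in> I" for I s v t
  proof -
    obtain x where ev: "\<forall>\<^sub>F \<tau> in nhds t. s \<tau> = proj T (x \<tau>)"
      and x: "(x has_real_derivative v t) (at t)"
      and v: "(v has_real_derivative \<Psi>1 (s t) + \<Psi>2 (s t) * (v t)\<^sup>2) (at t)"
      using sol by (auto simp: solution_on_def has_velocity_def)
    have st: "s t = proj T (x t)"
      using eventually_nhds_x_imp_x[OF ev] .
    have "((\<lambda>\<tau>. ?M (x \<tau>) * v \<tau>) has_real_derivative partial_s T ?L (s t, v t)) (at t)"
      using DERIV_mult[OF DERIV_chain2[OF DM x] v]
      by (simp add: st Ls algebra_simps power2_eq_square)
    moreover have "\<forall>\<^sub>F \<tau> in nhds t. partial_v ?L (s \<tau>, v \<tau>) = ?M (x \<tau>) * v \<tau>"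
      using ev by eventually_elim (simp add: Lv)
    ultimately show ?thesis
      by (simp cong: DERIV_cong_ev)
  qed
  then show ?thesis
    using smooth pos unfolding EL_with_def maximal_solution_on_def tangent_bundle_def
    by (fastforce simp: Lvv)
qed

section \<open>The equivalence\<close>

lemma ex1_circle_lift:
  assumes f: "periodic_fun_simple f T" and "smooth f" "range f \<subseteq> A"
  shows "\<exists>!F. F \<in> circle T \<rightarrow>\<^sub>E A \<and> smooth_circle T F \<and> f = F \<circ> proj T"
proof -
  interpret periodic_fun_simple f T by fact
  define F where "F = restrict (\<lambda>s. f (SOME x. proj T x = s)) (circle T)"
  have F: "F (proj T x) = f x" for x
  proof -
    have "proj T (SOME y. proj T y = proj T x) = proj T x"
      by (rule someI[of "\<lambda>y. proj T y = proj T x"]) simp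
    then obtain n where "x = (SOME y. proj T y = proj T x) + of_int n * T"
      by (auto simp: proj_eq_iff)
    then show ?thesis
      unfolding F_def using plus_of_int[of "SOME y. proj T y = proj T x" n] proj_in_circle by simp
  qed
  show ?thesis
  proof (rule ex1I[of _ F])
    show "F \<in> circle T \<rightarrow>\<^sub>E A \<and> smooth_circle T F \<and> f = F \<circ> proj T"
      using assms(2,3) F by (auto simp: smooth_circle_def o_def F_def)
    fix G assume G: "G \<in> circle T \<rightarrow>\<^sub>E A \<and> smooth_circle T G \<and> f = G \<circ> proj T"
    show "G = F"
    proof (rule extensionalityI[of _ "circle T"])
      show "G s = F s" if "s \<in> circle T" for s
        using that G F by (auto elim!: circleE)
    qed (use G in \<open>auto simp: F_def PiE_def\<close>)
  qed
qed

theorem theorem3p5: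
  fixes T :: real and \<Psi>1 \<Psi>2 :: "real set \<Rightarrow> real"
  assumes "T > 0" and "smooth_circle T \<Psi>1" and "smooth_circle T \<Psi>2"
  shows "(EL T \<Psi>1 \<Psi>2 \<longleftrightarrow> mechanical T \<Psi>1 \<Psi>2) \<and>
    (mechanical T \<Psi>1 \<Psi>2 \<longleftrightarrow>
      periodic_fun_simple (virtual_mass T \<Psi>2) T \<and>
      periodic_fun_simple (virtual_potential T \<Psi>1 \<Psi>2) T) \<and>
    (EL T \<Psi>1 \<Psi>2 \<longrightarrow>
      (\<exists>!M. M \<in> circle T \<rightarrow>\<^sub>E {0<..} \<and> smooth_circle T M \<and>
         virtual_mass T \<Psi>2 = M \<circ> proj T) \<and>
      (\<exists>!V. V \<in> circle T \<rightarrow>\<^sub>E UNIV \<and> smooth_circle T V \<and>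
         virtual_potential T \<Psi>1 \<Psi>2 = V \<circ> proj T) \<and>
      (\<forall>M V. M \<in> circle T \<rightarrow> {0<..} \<and> smooth_circle T M \<and>
         virtual_mass T \<Psi>2 = M \<circ> proj T \<and>
         smooth_circle T V \<and> virtual_potential T \<Psi>1 \<Psi>2 = V \<circ> proj T \<longrightarrow>
         EL_with T \<Psi>1 \<Psi>2 (mech_lagrangian M V)))"
proof -
  note \<Psi> = assms(2,3)
  define periodic where "periodic \<longleftrightarrow> periodic_fun_simple (virtual_mass T \<Psi>2) T \<and>
      periodic_fun_simple (virtual_potential T \<Psi>1 \<Psi>2) T"
  have mech_EL: "mechanical T \<Psi>1 \<Psi>2 \<Longrightarrow> EL T \<Psi>1 \<Psi>2"
    by (auto simp: mechanical_def EL_def)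
  have EL_periodic: periodic if EL: "EL T \<Psi>1 \<Psi>2"
  proof -
    obtain L where "EL_with T \<Psi>1 \<Psi>2 L"
      using EL by (auto simp: EL_def)
    note EL_with_imp_trivial_holonomy[OF this \<open>T > 0\<close> \<Psi>]
    then show ?thesis
      unfolding periodic_def periodic_fun_simple_def
      using virtual_mass_periodic[OF \<Psi>(2)] virtual_potential_periodic[OF \<Psi>] by blast
  qed
  have lifts: "\<exists>!M. M \<in> circle T \<rightarrow>\<^sub>E {0<..} \<and> smooth_circle T M \<and>
         virtual_mass T \<Psi>2 = M \<circ> proj T"
      "\<exists>!V. V \<in> circle T \<rightarrow>\<^sub>E UNIV \<and> smooth_circle T V \<and>
         virtual_potential T \<Psi>1 \<Psi>2 = V \<circ> proj T" if periodic
    using that unfolding periodic_def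
    by (intro ex1_circle_lift smooth_virtual_mass smooth_virtual_potential \<Psi>;
        auto simp: virtual_mass_pos)+
  have "mechanical T \<Psi>1 \<Psi>2" if periodic: periodic
  proof -
    obtain M V where "M \<in> circle T \<rightarrow>\<^sub>E {0<..}" "smooth_circle T M" "smooth_circle T V"
      "virtual_mass T \<Psi>2 = M \<circ> proj T" "virtual_potential T \<Psi>1 \<Psi>2 = V \<circ> proj T"
      using lifts[OF periodic] by blast
    then show ?thesis
      unfolding mechanical_def using EL_with_mech_lagrangian[OF \<Psi>, of M V]
      by (auto simp: PiE_def)
  qed
  then show ?thesis
    using mech_EL EL_periodic lifts EL_with_mech_lagrangian[OF \<Psi>] unfolding periodic_def by blast
qed

end
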